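(* Let $m\in\mathbb{N}$ and let $\mathbf b=(b_n)_{n\ge0}$ be complex numbers with $b_0\neq0$; let $\alpha_0,\ldots,\alpha_{m-1}$ and $M_0,\ldots,M_{m-1}$ be as in the context. (i) If for every $k=0,\ldots,m-1$ the series $M_k(s)$ converges at $s=1$, then for all $k$, $$\lim_{s\to1^-}M_k(s)=\lim_{n\to\infty}\alpha_k(n).$$ (ii) If, in addition to the hypothesis of (i), $b_0+b_1+b_2+\cdots=1$, the series $\sum_{j\ge1}jb_j$ converges and $m\neq\sum_{j=1}^\infty jb_j$, then $$\lim_{n\to\infty}\alpha_k(n)=\frac{\sum_{j=k}^{m-1}b_{j-k}}{m-\sum_{j=1}^{\infty}jb_j},\qquad k=0,1,\ldots,m-1.$$
   Context: For each $k\in\{0,\ldots,m-1\}$ the sequence $(\alpha_k(n))_{n\ge0}$ is defined by $\alpha_k(j)=1$ if $j=k$, $\alpha_k(j)=0$ if $j\in\{0,\ldots,m-1\}\setminus\{k\}$, and for $n\ge m$ by $\alpha_k(n)=\frac{1}{b_0}\big(\alpha_k(n-m)-\sum_{j=0}^{n-1}b_{n-j}\alpha_k(j)\big)$. $G\alpha_k(s)=\sum_{n\ge0}\alpha_k(n)s^n$, and $M_k(s)$ is the Maclaurin series of $(1-s)G\alpha_k(s)$, namely $M_k(s)=\alpha_k(0)+\sum_{n\ge1}(\alpha_k(n)-\alpha_k(n-1))s^n$. *)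

theory Defs
  imports "HOL-Analysis.Analysis" "HOL-Computational_Algebra.Formal_Power_Series"
begin

text \<open>The recursion is only meaningful for \<open>m > 0\<close>; the guard \<open>m = 0\<close> gives a
  conventional value to a case in which there is no index \<open>k < m\<close>.\<close>

function alpha :: "(nat \<Rightarrow> complex) \<Rightarrow> nat \<Rightarrow> nat \<Rightarrow> nat \<Rightarrow> complex" where
  "alpha b m k n =
     (if m = 0 then 0
      else if n < m then (if n = k then 1 else 0)
      else 1 / b 0 * (alpha b m k (n - m) - (\<Sum>j<n. b (n - j) * alpha b m k j)))"
  by pat_completeness auto
termination
  by (relation "Wellfounded.measure (\<lambda>(b, m, k, n). n)") auto

declare alpha.simps [simp del]

definition G_alpha :: "(nat \<Rightarrow> complex) \<Rightarrow> nat \<Rightarrow> nat \<Rightarrow> complex fps" where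
  "G_alpha b m k = Abs_fps (alpha b m k)"

definition M_series :: "(nat \<Rightarrow> complex) \<Rightarrow> nat \<Rightarrow> nat \<Rightarrow> complex fps" where
  "M_series b m k = (1 - fps_X) * G_alpha b m k"

lemma M_series_nth:
  "fps_nth (M_series b m k) n =
     (if n = 0 then alpha b m k 0 else alpha b m k n - alpha b m k (n - 1))"
  by (simp add: M_series_def G_alpha_def left_diff_distrib)

end

theory Submission
  imports Defs
begin

text \<open>
  The recursion says that the generating functions satisfy
  \<open>(B(s) - s\<^sup>m) M\<^sub>k(s) = (1 - s) P\<^sub>k(s)\<close>, where \<open>P\<^sub>k\<close> is a polynomial with
  \<open>P\<^sub>k(1) = \<Sum>j=k..<m. b\<^bsub>j - k\<^esub>\<close>. The partial sums of \<open>M\<^sub>k(1)\<close> are the \<open>\<alpha>\<^sub>k(n)\<close>, so Abel's limit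
  theorem gives (i). Applied to \<open>B'\<close>, the same theorem shows that \<open>B\<close> has the left derivative
  \<open>\<Sum>j b\<^sub>j\<close> at 1; dividing the identity by \<open>1 - s\<close> and letting \<open>s\<close> tend to 1 gives (ii).
\<close>

section \<open>Abel's limit theorem\<close>

text \<open>The remainder estimate behind Abel's theorem. Coefficients below \<open>e / 2\<close>
  contribute at most \<open>e / 2 / (1 - s)\<close>, which the factor \<open>1 - s\<close> cancels;
  the finitely many others have a bounded sum, which the same factor sends to 0.\<close>

lemma Abel_mean_null:
  fixes c :: "nat \<Rightarrow> 'a :: {banach, real_normed_field}"
  assumes c: "c \<longlonglongrightarrow> 0"
  shows "((\<lambda>s::real. of_real (1 - s) * eval_fps (Abs_fps c) (of_real s)) \<longlongrightarrow> 0) (at_left 1)"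
proof (rule tendstoI)
  fix e :: real assume e: "e > 0"
  obtain N where N: "\<And>n. n \<ge> N \<Longrightarrow> norm (c n) < e / 2"
    using LIMSEQ_D[OF c, of "e / 2"] e by auto
  \<comment> \<open>This bound only secures absolute convergence for \<open>s < 1\<close>; the
    estimate itself rests on \<open>N\<close> and \<open>K\<close>.\<close>
  obtain C where C: "\<And>n. norm (c n) \<le> C"
    using convergent_imp_Bseq[of c] c by (auto simp: convergent_def Bseq_def)
  define K where "K = (\<Sum>n<N. norm (c n))"
  have K0: "K \<ge> 0" unfolding K_def by (intro sum_nonneg) auto
  have bound: "norm (of_real (1 - s) * eval_fps (Abs_fps c) (of_real s)) \<le> (1 - s) * K + e / 2"
    if s: "0 < s" "s < 1" for s :: real
  proof -
    have geo: "summable (\<lambda>n. s ^ n)" using s by (simp add: summable_geometric)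
    have sm: "summable (\<lambda>n. norm (c n) * s ^ n)"
      by (rule summable_comparison_test'[of "\<lambda>n. C * s ^ n" 0])
         (use s C geo in \<open>auto intro!: summable_mult mult_right_mono\<close>)
    have "norm (eval_fps (Abs_fps c) (of_real s)) \<le> (\<Sum>n. norm (c n) * s ^ n)"
      unfolding eval_fps_def using s sm
      by (intro order.trans[OF summable_norm]) (auto simp: norm_mult norm_power)
    also have "\<dots> = (\<Sum>n. norm (c (n + N)) * s ^ (n + N)) + (\<Sum>n<N. norm (c n) * s ^ n)"
      by (rule suminf_split_initial_segment[OF sm])
    also have "(\<Sum>n<N. norm (c n) * s ^ n) \<le> K"
      unfolding K_def using s by (intro sum_mono) (auto simp: power_le_one mult_left_le)
    also have "(\<Sum>n. norm (c (n + N)) * s ^ (n + N)) \<le> (\<Sum>n. e / 2 * s ^ n)"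
    proof (rule suminf_le)
      show "norm (c (n + N)) * s ^ (n + N) \<le> e / 2 * s ^ n" for n
        using N[of "n + N"] s e by (intro mult_mono power_decreasing) auto
      show "summable (\<lambda>n. norm (c (n + N)) * s ^ (n + N))"
        using summable_ignore_initial_segment[OF sm] by simp
      show "summable (\<lambda>n. e / 2 * s ^ n)" by (rule summable_mult[OF geo])
    qed
    also have "(\<Sum>n. e / 2 * s ^ n) = e / 2 / (1 - s)"
      using s by (subst suminf_mult[OF geo]) (simp add: suminf_geometric)
    finally have "(1 - s) * norm (eval_fps (Abs_fps c) (of_real s)) \<le> (1 - s) * (e / 2 / (1 - s) + K)"
      using s by (intro mult_left_mono) auto
    also have "\<dots> = (1 - s) * K + e / 2"
      using s by (simp add: field_simps)
    finally show ?thesis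
      using s by (simp add: norm_mult del: of_real_diff)
  qed
  have "((\<lambda>s. (1 - s) * K) \<longlongrightarrow> (1 - 1) * K) (at_left (1::real))"
    by (intro tendsto_intros)
  then have "\<forall>\<^sub>F s in at_left 1. (1 - s) * K < e / 2"
    using order_tendstoD(2)[of _ 0 _ "e / 2"] e by simp
  moreover have "\<forall>\<^sub>F s in at_left 1. s \<in> {0<..<(1::real)}"
    by (rule eventually_at_leftI[of 0]) auto
  ultimately show "\<forall>\<^sub>F s in at_left 1.
      dist (of_real (1 - s) * eval_fps (Abs_fps c) (of_real s)) 0 < e"
  proof eventually_elim
    case (elim s)
    then show ?case using bound[of s] by (simp only: dist_0_norm dist_commute[of _ 0]) auto
  qed
qed

lemma conv_radius_ge_1_if_bounded:
  fixes c :: "nat \<Rightarrow> 'a :: {banach, real_normed_field}"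
  assumes "Bseq c"
  shows "conv_radius c \<ge> 1"
proof (rule conv_radius_geI_ex')
  fix r :: real assume r: "0 < r" "ereal r < 1"
  obtain C where C: "\<And>n. norm (c n) \<le> C" using assms by (auto simp: Bseq_def)
  show "summable (\<lambda>n. c n * of_real r ^ n)"
    by (rule summable_comparison_test'[of "\<lambda>n. C * r ^ n" 0])
       (use r C in \<open>auto intro!: summable_mult mult_right_mono simp: norm_mult norm_power\<close>)
qed

lemma fps_conv_radius_ge_1_if_summable:
  fixes F :: "'a :: {banach, real_normed_field} fps"
  assumes "summable (fps_nth F)"
  shows "fps_conv_radius F \<ge> 1"
  unfolding fps_conv_radius_def
  using conv_radius_ge_1_if_bounded convergent_imp_Bseq summable_LIMSEQ_zero[OF assms]
  by (blast intro: convergentI)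

text \<open>Summation by parts: with the errors of the partial sums as coefficients of
  \<open>H\<close>, the difference \<open>F - L\<close> is \<open>(1 - X) * H\<close>, and
  \<open>Abel_mean_null\<close> applies because these errors tend to 0.\<close>

theorem Abel_limit:
  fixes F :: "'a :: {banach, real_normed_field} fps"
  assumes F: "fps_nth F sums L"
  shows "((\<lambda>s::real. eval_fps F (of_real s)) \<longlongrightarrow> L) (at_left 1)"
proof -
  define H where "H = Abs_fps (\<lambda>n. (\<Sum>i\<le>n. fps_nth F i) - L)"
  have H0: "(\<lambda>n. (\<Sum>i\<le>n. fps_nth F i) - L) \<longlonglongrightarrow> 0"
    using F by (simp add: sums_def_le LIM_zero)
  \<comment> \<open>Consecutive errors differ by a coefficient of \<open>F\<close>; at index 0 there
    is no predecessor, and the \<open>- L\<close> in \<open>H\<close> accounts for the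
    constant.\<close>
  have FH: "F - fps_const L = (1 - fps_X) * H"
  proof (rule fps_ext)
    fix n show "fps_nth (F - fps_const L) n = fps_nth ((1 - fps_X) * H) n"
      by (cases n) (simp_all add: H_def left_diff_distrib)
  qed
  have radF: "fps_conv_radius F \<ge> 1"
    using F by (intro fps_conv_radius_ge_1_if_summable) (rule sums_summable)
  have radH: "fps_conv_radius H \<ge> 1"
    unfolding fps_conv_radius_def H_def fps_nth_Abs_fps
    using H0 by (intro conv_radius_ge_1_if_bounded convergent_imp_Bseq convergentI)
  have "eval_fps F (of_real s) = L + of_real (1 - s) * eval_fps H (of_real s)"
    if s: "s \<in> {0<..<1}" for s :: real
  proof -
    have n: "norm (of_real s :: 'a) < fps_conv_radius F" "norm (of_real s :: 'a) < fps_conv_radius H"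
      using s radF radH by (auto intro: less_le_trans[of _ 1])
    have r1: "fps_conv_radius (1 - fps_X :: 'a fps) \<ge> \<infinity>"
      using fps_conv_radius_diff[of "1 :: 'a fps" fps_X] by simp
    have "eval_fps F (of_real s) - L = eval_fps (F - fps_const L) (of_real s)"
      using n by (subst eval_fps_diff) auto
    also have "\<dots> = of_real (1 - s) * eval_fps H (of_real s)"
      unfolding FH using n r1 by (subst eval_fps_mult) (auto simp: eval_fps_diff)
    finally show ?thesis by (simp add: algebra_simps)
  qed
  then have "\<forall>\<^sub>F s in at_left 1.
      L + of_real (1 - s) * eval_fps H (of_real s) = eval_fps F (of_real s)"
    by (intro eventually_at_leftI[of 0]) auto
  moreover have "((\<lambda>s::real. L + of_real (1 - s) * eval_fps H (of_real s)) \<longlongrightarrow> L + 0) (at_left 1)"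
    unfolding H_def by (intro tendsto_intros Abel_mean_null H0)
  ultimately show ?thesis
    by (simp add: tendsto_cong)
qed

section \<open>One-sided derivative at the boundary point\<close>

text \<open>By Abel's theorem the derivative inside the disc tends to \<open>D\<close>, and the mean
  value inequality on \<open>{s..1}\<close> carries this over to the difference quotient. An
  inequality is used because the values need not be real.\<close>

lemma eval_fps_left_difference_quotient:
  fixes F :: "'a :: {banach, real_normed_field} fps"
  assumes F: "fps_nth F sums L" and F': "fps_nth (fps_deriv F) sums D"
  shows "((\<lambda>s::real. (L - eval_fps F (of_real s)) / of_real (1 - s)) \<longlongrightarrow> D) (at_left 1)"
proof (rule tendstoI)
  fix e :: real assume e: "e > 0"
  have radF: "fps_conv_radius F \<ge> 1"
    using F by (intro fps_conv_radius_ge_1_if_summable) (rule sums_summable)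
  have "\<forall>\<^sub>F s in at_left 1. dist (eval_fps (fps_deriv F) (of_real s)) D < e / 2"
    using Abel_limit[OF F'] e by (auto dest: tendstoD[of _ _ _ "e / 2"])
  then obtain d where d: "d < 1"
    "\<And>s. d < s \<Longrightarrow> s < 1 \<Longrightarrow> dist (eval_fps (fps_deriv F) (of_real s)) D < e / 2"
    unfolding eventually_at_left_field by blast
  \<comment> \<open>Subtracting \<open>of_real s * D\<close> makes the derivative small near 1, and
    \<open>(g 1 - g s) / (1 - s)\<close> is the difference quotient minus \<open>D\<close>. The
    value \<open>L\<close> at 1 is the one for which \<open>Abel_limit\<close> yields left
    continuity.\<close>
  define g where "g = (\<lambda>s::real. (if s = 1 then L else eval_fps F (of_real s)) - of_real s * D)"
  have "dist ((L - eval_fps F (of_real s)) / of_real (1 - s)) D < e"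
    if s: "max 0 d < s" "s < 1" for s :: real
  proof -
    have der: "(g has_vector_derivative (eval_fps (fps_deriv F) (of_real x) - D)) (at x)"
      if x: "0 < x" "x < 1" for x
    proof -
      have "(eval_fps F has_field_derivative eval_fps (fps_deriv F) (of_real x)) (at (of_real x))"
        using x radF by (intro has_field_derivative_eval_fps) (auto intro: less_le_trans[of _ 1])
      then have "((\<lambda>s. eval_fps F (of_real s) - of_real s * D) has_vector_derivative
          (eval_fps (fps_deriv F) (of_real x) - D)) (at x)"
        by (auto intro!: derivative_eq_intros has_vector_derivative_real_field)
      then show ?thesis
        unfolding g_def
        by (rule has_vector_derivative_transform_within_open[where S = "{0<..<1}"]) (use x in auto)
    qed
    have cont1: "(g \<longlongrightarrow> g 1) (at_left 1)"
    proof -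
      have "((\<lambda>s. eval_fps F (of_real s) - of_real s * D) \<longlongrightarrow> L - of_real 1 * D) (at_left (1::real))"
        by (intro tendsto_intros Abel_limit F)
      then show ?thesis
        by (rule Lim_transform_eventually[THEN tendsto_eq_rhs])
           (auto simp: g_def eventually_at_filter)
    qed
    have "continuous_on {s..1} g"
      unfolding continuous_on_eq_continuous_within
    proof
      fix x assume x: "x \<in> {s..1}"
      show "continuous (at x within {s..1}) g"
      proof (cases "x = 1")
        case True
        then show ?thesis
          using cont1 s by (simp add: continuous_within at_within_Icc_at_left)
      next
        case False
        then have "continuous (at x) g"
          using der[of x] x s by (auto intro: has_vector_derivative_continuous)
        then show ?thesis by (rule continuous_at_imp_continuous_at_within)
      qed
    qed
    \<comment> \<open>Mean value inequality with majorant \<open>e / 2 * x\<close>. Derivatives are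
      required only in the open interval, so continuity suffices at the endpoint 1.\<close>
    then have "norm (g 1 - g s) \<le> e / 2 * 1 - e / 2 * s"
    proof (rule differentiable_bound_general[OF s(2)])
      show "continuous_on {s..1} (\<lambda>x. e / 2 * x)" by (intro continuous_intros)
      show "(g has_vector_derivative (eval_fps (fps_deriv F) (of_real x) - D)) (at x)"
        if "s < x" "x < 1" for x using der that s by auto
      show "((\<lambda>x. e / 2 * x) has_vector_derivative e / 2) (at x)" for x
        by (auto intro!: derivative_eq_intros)
      show "norm (eval_fps (fps_deriv F) (of_real x) - D) \<le> e / 2" if "s < x" "x < 1" for x
        using d(2)[of x] that s by (auto simp: dist_norm)
    qed
    moreover have "(L - eval_fps F (of_real s)) / of_real (1 - s) - D = (g 1 - g s) / of_real (1 - s)"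
      using s by (simp add: g_def divide_simps del: of_real_diff) (simp add: algebra_simps)
    ultimately have "dist ((L - eval_fps F (of_real s)) / of_real (1 - s)) D \<le> e / 2"
      using s unfolding dist_norm by (simp only: norm_divide norm_of_real) (simp add: field_simps)
    then show ?thesis using e by simp
  qed
  then show "\<forall>\<^sub>F s in at_left 1. dist ((L - eval_fps F (of_real s)) / of_real (1 - s)) D < e"
    using d(1) by (intro eventually_at_leftI[of "max 0 d"]) auto
qed

section \<open>Generating function identities\<close>

text \<open>Compare coefficients. For \<open>n < m\<close> the initial values leave only the term
  \<open>j = k\<close> of the convolution; for \<open>n \<ge> m\<close> the recursion makes the
  convolution equal to the coefficient coming from \<open>fps_X ^ m\<close>.\<close>

lemma G_alpha_equation:
  assumes b0: "b 0 \<noteq> 0" and k: "k < m"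
  shows "(Abs_fps b - fps_X ^ m) * G_alpha b m k = (\<Sum>n=k..<m. fps_const (b (n - k)) * fps_X ^ n)"
proof (rule fps_ext)
  fix n
  let ?a = "alpha b m k"
  have conv: "fps_nth (Abs_fps b * G_alpha b m k) n = (\<Sum>j\<le>n. b (n - j) * ?a j)"
    by (subst mult.commute)
       (simp add: fps_mult_nth G_alpha_def atLeast0AtMost mult.commute[of "b _"])
  have rhs: "fps_nth (\<Sum>i=k..<m. fps_const (b (i - k)) * fps_X ^ i) n
      = (if k \<le> n \<and> n < m then b (n - k) else 0)"
    by (simp add: fps_sum_nth if_distrib[of "(*) _"] fps_X_power_iff cong: if_cong)
  have shift: "fps_nth (fps_X ^ m * G_alpha b m k) n = (if n < m then 0 else ?a (n - m))"
    by (simp add: fps_X_power_mult_nth G_alpha_def)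
  have "(\<Sum>j\<le>n. b (n - j) * ?a j) = (if n < m then 0 else ?a (n - m)) + (if k \<le> n \<and> n < m then b (n - k) else 0)"
  proof (cases "n < m")
    case True
    have "(\<Sum>j\<le>n. b (n - j) * ?a j) = (\<Sum>j\<le>n. if j = k then b (n - j) else 0)"
      using True by (intro sum.cong) (auto simp: alpha.simps)
    then show ?thesis using True by simp
  next
    case False
    have "?a n = 1 / b 0 * (?a (n - m) - (\<Sum>j<n. b (n - j) * ?a j))"
      using False k by (subst alpha.simps) auto
    \<comment> \<open>Clearing the denominator supplies the term \<open>j = n\<close> that the sum
      over \<open>j < n\<close> lacks.\<close>
    then have "b 0 * ?a n + (\<Sum>j<n. b (n - j) * ?a j) = ?a (n - m)"
      using b0 by (simp add: field_simps)
    then show ?thesis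
      using False by (simp add: lessThan_Suc_atMost[symmetric] add.commute)
  qed
  then show "fps_nth ((Abs_fps b - fps_X ^ m) * G_alpha b m k) n
      = fps_nth (\<Sum>n=k..<m. fps_const (b (n - k)) * fps_X ^ n) n"
    by (simp add: left_diff_distrib conv shift rhs)
qed

lemma M_series_partial_sums: "(\<Sum>i\<le>n. fps_nth (M_series b m k) i) = alpha b m k n"
  by (induction n) (simp_all add: M_series_nth)

lemma M_series_sums_iff: "fps_nth (M_series b m k) sums L \<longleftrightarrow> alpha b m k \<longlonglongrightarrow> L"
  by (simp add: sums_def_le M_series_partial_sums)

text \<open>Multiplying \<open>G_alpha_equation\<close> by \<open>1 - fps_X\<close> replaces
  \<open>G_alpha\<close> by \<open>M_series\<close>. Convergence at 1 gives both series radius at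
  least 1, so the formal identity may be evaluated inside the unit disc.\<close>

lemma eval_M_series_equation:
  fixes z :: complex
  assumes b0: "b 0 \<noteq> 0" and k: "k < m" and z: "norm z < 1"
    and b: "summable b" and M: "summable (fps_nth (M_series b m k))"
  shows "(eval_fps (Abs_fps b) z - z ^ m) * eval_fps (M_series b m k) z
    = (1 - z) * (\<Sum>n=k..<m. b (n - k) * z ^ n)"
proof -
  let ?B = "Abs_fps b" and ?M = "M_series b m k"
  let ?P = "\<Sum>n=k..<m. fps_const (b (n - k)) * fps_X ^ n"
  have nth_B: "fps_nth ?B = b" by (rule ext) simp
  have eq: "(?B - fps_X ^ m) * ?M = (1 - fps_X) * ?P"
    using G_alpha_equation[of b, OF b0 k] unfolding M_series_def by (metis mult.left_commute)
  have B: "norm z < fps_conv_radius ?B"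
    using fps_conv_radius_ge_1_if_summable[of ?B] b z nth_B by (auto intro: less_le_trans[of _ 1])
  have M: "norm z < fps_conv_radius ?M"
    using fps_conv_radius_ge_1_if_summable[OF M] z by (auto intro: less_le_trans[of _ 1])
  have BX: "norm z < fps_conv_radius (?B - fps_X ^ m)"
    using B fps_conv_radius_diff[of ?B "fps_X ^ m"] by (auto intro: less_le_trans)
  have X: "fps_conv_radius (1 - fps_X :: complex fps) = \<infinity>"
    using fps_conv_radius_diff[of "1 :: complex fps" fps_X] by simp
  have Q: "fps_conv_radius (fps_const c * fps_X ^ n :: complex fps) = \<infinity>" for c n
    using fps_conv_radius_mult[of "fps_const c" "fps_X ^ n"] by simp
  \<comment> \<open>Radius and value go through one induction, since evaluating a sum termwise needs
    the radius of the smaller sum.\<close>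
  have P: "fps_conv_radius (\<Sum>n\<in>A. fps_const (b (n - k)) * fps_X ^ n) = \<infinity> \<and>
      eval_fps (\<Sum>n\<in>A. fps_const (b (n - k)) * fps_X ^ n) z = (\<Sum>n\<in>A. b (n - k) * z ^ n)"
    if "finite A" for A
    using that
  proof induction
    case (insert a A)
    then show ?case
      using fps_conv_radius_add[of "fps_const (b (a - k)) * fps_X ^ a"
          "\<Sum>n\<in>A. fps_const (b (n - k)) * fps_X ^ n"]
      by (simp add: Q eval_fps_add eval_fps_mult)
  qed auto
  have "(eval_fps ?B z - z ^ m) * eval_fps ?M z = eval_fps ((?B - fps_X ^ m) * ?M) z"
    using B M BX by (simp add: eval_fps_mult eval_fps_diff)
  also have "\<dots> = (1 - z) * (\<Sum>n=k..<m. b (n - k) * z ^ n)"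
    unfolding eq using X P[of "{k..<m}"] by (simp add: eval_fps_mult eval_fps_diff)
  finally show ?thesis .
qed

section \<open>The value of the limit\<close>

text \<open>Since \<open>b\<close> sums to 1, both \<open>B(s)\<close> and \<open>s ^ m\<close> tend
  to 1, and \<open>B(s) - s ^ m\<close> is \<open>1 - s\<close> times a difference
  \<open>p s - q s\<close> of quotients with limits \<open>m\<close> and \<open>D\<close>.
  Cancelling \<open>1 - s\<close> leaves a polynomial whose value at 1 is
  \<open>(m - D) * L\<close>.\<close>

lemma alpha_limit:
  assumes b0: "b 0 \<noteq> 0" and k: "k < m" and L: "alpha b m k \<longlonglongrightarrow> L"
    and b: "b sums 1" and D: "(\<lambda>j. of_nat (Suc j) * b (Suc j)) sums D" and mD: "of_nat m \<noteq> D"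
  shows "L = (\<Sum>j=k..<m. b (j - k)) / (of_nat m - D)"
proof -
  let ?B = "Abs_fps b" and ?M = "M_series b m k"
  have M: "fps_nth ?M sums L" using L by (simp add: M_series_sums_iff)
  define q where "q = (\<lambda>s::real. (1 - eval_fps ?B (complex_of_real s)) / of_real (1 - s))"
  define p where "p = (\<lambda>s::real. (1 - complex_of_real s ^ m) / of_real (1 - s))"
  have q: "(q \<longlongrightarrow> D) (at_left 1)"
    unfolding q_def using b D
    by (intro eval_fps_left_difference_quotient) (simp_all add: sums_def)
  have p: "(p \<longlongrightarrow> of_nat m) (at_left 1)"
  proof -
    have "((\<lambda>s. \<Sum>i<m. complex_of_real s ^ i) \<longlongrightarrow> (\<Sum>i<m. complex_of_real 1 ^ i)) (at_left 1)"
      by (intro tendsto_intros)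
    \<comment> \<open>For \<open>s < 1\<close> the quotient \<open>p s\<close> is a geometric sum of
      \<open>m\<close> terms, each tending to 1.\<close>
    moreover have "\<forall>\<^sub>F s in at_left 1. (\<Sum>i<m. complex_of_real s ^ i) = p s"
      by (intro eventually_at_leftI[of 0]) (auto simp: p_def geometric_sum_less one_diff_power_eq)
    ultimately show ?thesis by (simp add: tendsto_cong)
  qed
  have "((\<lambda>s. (p s - q s) * eval_fps ?M (of_real s)) \<longlongrightarrow> (of_nat m - D) * L) (at_left 1)"
    by (intro tendsto_intros p q Abel_limit M)
  moreover have "\<forall>\<^sub>F s in at_left 1. (p s - q s) * eval_fps ?M (of_real s)
      = (\<Sum>n=k..<m. b (n - k) * complex_of_real s ^ n)"
  proof (rule eventually_at_leftI[of 0])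
    fix s :: real assume s: "s \<in> {0<..<1}"
    have "(1 - of_real s) * ((p s - q s) * eval_fps ?M (of_real s))
      = (eval_fps ?B (of_real s) - of_real s ^ m) * eval_fps ?M (of_real s)"
      using s by (simp add: p_def q_def divide_simps)
    also have "\<dots> = (1 - of_real s) * (\<Sum>n=k..<m. b (n - k) * complex_of_real s ^ n)"
      using s b M by (intro eval_M_series_equation b0 k) (auto simp: sums_iff)
    finally show "(p s - q s) * eval_fps ?M (of_real s)
      = (\<Sum>n=k..<m. b (n - k) * complex_of_real s ^ n)"
      using s by (simp flip: of_real_diff)
  qed auto
  ultimately have "((\<lambda>s. \<Sum>n=k..<m. b (n - k) * complex_of_real s ^ n) \<longlongrightarrow> (of_nat m - D) * L) (at_left 1)"
    by (simp add: tendsto_cong)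
  moreover have "((\<lambda>s. \<Sum>n=k..<m. b (n - k) * complex_of_real s ^ n)
      \<longlongrightarrow> (\<Sum>n=k..<m. b (n - k) * complex_of_real 1 ^ n)) (at_left 1)"
    by (intro tendsto_intros)
  ultimately have "(of_nat m - D) * L = (\<Sum>n=k..<m. b (n - k) * complex_of_real 1 ^ n)"
    by (intro tendsto_unique) auto
  then show ?thesis using mD by (simp add: field_simps)
qed

text \<open>The common witness \<open>L\<close> in (i) expresses that both limits exist and agree.
  The factor \<open>1 ^ n\<close> stands for evaluation at 1, and \<open>Suc j\<close> shifts the
  sum over indices from 1 on to one starting at 0.\<close>

theorem theorem2:
  fixes m :: nat and b :: "nat \<Rightarrow> complex"
  assumes "b 0 \<noteq> 0"
    and "\<forall>k<m. summable (\<lambda>n. fps_nth (M_series b m k) n * 1 ^ n)"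
  shows "(\<forall>k<m. \<exists>L. ((\<lambda>s::real. eval_fps (M_series b m k) (complex_of_real s)) \<longlongrightarrow> L) (at_left 1)
               \<and> alpha b m k \<longlonglongrightarrow> L) \<and>
         (b sums 1 \<longrightarrow> summable (\<lambda>j. of_nat (Suc j) * b (Suc j)) \<longrightarrow>
           of_nat m \<noteq> (\<Sum>j. of_nat (Suc j) * b (Suc j)) \<longrightarrow>
           (\<forall>k<m. alpha b m k \<longlonglongrightarrow>
             (\<Sum>j=k..<m. b (j - k)) / (of_nat m - (\<Sum>j. of_nat (Suc j) * b (Suc j)))))"
proof -
  have "\<exists>L. fps_nth (M_series b m k) sums L" if "k < m" for k
    using assms(2) that by (auto simp: summable_def)
  then obtain L where L: "\<And>k. k < m \<Longrightarrow> fps_nth (M_series b m k) sums L k" by metis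
  then have lim: "\<And>k. k < m \<Longrightarrow> alpha b m k \<longlonglongrightarrow> L k" by (simp add: M_series_sums_iff)
  show ?thesis
  proof (intro conjI allI impI)
    fix k assume "k < m"
    then show "\<exists>L. ((\<lambda>s::real. eval_fps (M_series b m k) (complex_of_real s)) \<longlongrightarrow> L) (at_left 1)
               \<and> alpha b m k \<longlonglongrightarrow> L"
      using Abel_limit[OF L] lim by blast
  next
    fix k assume "b sums 1" "summable (\<lambda>j. of_nat (Suc j) * b (Suc j))"
      "of_nat m \<noteq> (\<Sum>j. of_nat (Suc j) * b (Suc j))" "k < m"
    then show "alpha b m k \<longlonglongrightarrow>
        (\<Sum>j=k..<m. b (j - k)) / (of_nat m - (\<Sum>j. of_nat (Suc j) * b (Suc j)))"
      \<comment> \<open>The limit \<open>L k\<close> is already known to exist;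
        \<open>alpha_limit\<close> only identifies its value.\<close>
      using alpha_limit[OF assms(1) _ lim _ summable_sums] lim by auto
  qed
qed

end
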